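(* Let $\mathcal{D}_Q=(Q_1,\dots,Q_n)$, $n\ge1$, be a decomposition of a query graph $Q$ such that each $Q_i$, $1\le i\le n$, is a subject-object star query. Let $\mathcal{D}_G=(G_1,\dots,G_m)$, $m\ge1$, be a star-oriented decomposition (s-decomposition) of a data graph $G$. Then $e$ is a total embedding of $Q$ in $G$ if and only if $e$ is the join of some mutually compatible embeddings $e_1,\dots,e_n$ such that for each $i$ with $1\le i\le n$, $e_i$ is a total embedding of $Q_i$ in some segment $G_j$, where $1\le j\le m$.
   Context: Fix countably infinite, pairwise disjoint sets $U_{so}$ and $U_p$ (URIs), $L$ (literals) and $\mathrm{Var}$ (variables). A data graph is a non-empty set of triples in $U_{so}\times U_p\times(U_{so}\cup L)$. A query graph (query) is a non-empty set of triples in $(U_{so}\cup \mathrm{Var})\times U_p\times (U_{so}\cup L\cup \mathrm{Var})$. In a triple $(s,p,o)$, $s$ is the subject and $o$ the object. For a data or query graph $F$, $\mathcal{N}(F)$ (nodes) is the set of all subjects and objects of triples of $F$. A decomposition of a query graph $Q$ is a tuple $(Q_1,\dots,Q_n)$, $n\ge1$, of query graphs (hence non-empty) with $Q_i\subseteq Q$ for all $i$ and $\bigcup_iQ_i=Q$. A subject-object star query (so-query) is a query $Q$ for which there is a node $c\in\mathcal{N}(Q)$ (the central node) such that every triple of $Q$ has $c$ as its subject or its object, and at least one triple of $Q$ has $c$ as its subject. A star-oriented decomposition (s-decomposition) of a data graph $G$ is a tuple $(G_1,\dots,G_m)$, $m\ge1$, for which there is a partition $(N_1,\dots,N_m)$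 of $\mathcal{N}(G)\setminus L$ such that, for each $i$, $G_i=\{(s,p,o)\in G \mid s\in N_i \text{ or } o\in N_i\}$. A (total) embedding of a query $Q$ in a data graph $G$ is a total map $e:\mathcal{N}(Q)\to\mathcal{N}(G)$ with $e(v)=v$ for every non-variable $v\in\mathcal{N}(Q)$ and $(e(v_1),p,e(v_2))\in G$ for every $(v_1,p,v_2)\in Q$. Two (partial) maps $e_1:D_1\to R_1$, $e_2:D_2\to R_2$ are compatible if $e_1(v)=e_2(v)$ for every $v\in D_1\cap D_2$ at which both are defined. The join of compatible $e_1,e_2$ is the (partial) map $D_1\cup D_2\to R_1\cup R_2$ equal to $e_1(v)$ where $e_1$ is defined and to $e_2(v)$ where only $e_2$ is defined; the join of finitely many mutually compatible maps is obtained by iterating. Maps into $\mathcal{N}(G_j)$ are regarded as maps into $\mathcal{N}(G)$. *)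

theory Defs
  imports "HOL-Library.Countable_Set" "HOL-Library.Disjoint_Sets"
begin

text \<open>All URIs, literals and variables live in one type \<open>'a\<close>; the four kinds of symbols are
  subsets of it, passed to the definitions that depend on them. Tuples are rendered as lists.\<close>

type_synonym 'a triple = "'a \<times> 'a \<times> 'a"

definition vocabulary :: "'a set \<Rightarrow> 'a set \<Rightarrow> 'a set \<Rightarrow> 'a set \<Rightarrow> bool" where
  "vocabulary Uso Up L Var \<longleftrightarrow>
     (\<forall>A \<in> {Uso, Up, L, Var}. countable A \<and> infinite A) \<and>
     disjnt Uso Up \<and> disjnt Uso L \<and> disjnt Uso Var \<and>
     disjnt Up L \<and> disjnt Up Var \<and> disjnt L Var"

definition data_graph :: "'a set \<Rightarrow> 'a set \<Rightarrow> 'a set \<Rightarrow> 'a triple set \<Rightarrow> bool" where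
  "data_graph Uso Up L G \<longleftrightarrow> G \<noteq> {} \<and> G \<subseteq> Uso \<times> Up \<times> (Uso \<union> L)"

definition query_graph :: "'a set \<Rightarrow> 'a set \<Rightarrow> 'a set \<Rightarrow> 'a set \<Rightarrow> 'a triple set \<Rightarrow> bool" where
  "query_graph Uso Up L Var Q \<longleftrightarrow>
     Q \<noteq> {} \<and> Q \<subseteq> (Uso \<union> Var) \<times> Up \<times> (Uso \<union> L \<union> Var)"

definition nodes :: "'a triple set \<Rightarrow> 'a set" where
  "nodes F = {v. \<exists>(s, p, t) \<in> F. v = s \<or> v = t}"

definition query_decomposition ::
    "'a set \<Rightarrow> 'a set \<Rightarrow> 'a set \<Rightarrow> 'a set \<Rightarrow> 'a triple set \<Rightarrow> 'a triple set list \<Rightarrow> bool" where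
  "query_decomposition Uso Up L Var Q Qs \<longleftrightarrow>
     Qs \<noteq> [] \<and>
     (\<forall>i < length Qs. query_graph Uso Up L Var (Qs ! i) \<and> Qs ! i \<subseteq> Q) \<and>
     (\<Union>i < length Qs. Qs ! i) = Q"

definition so_query :: "'a set \<Rightarrow> 'a set \<Rightarrow> 'a set \<Rightarrow> 'a set \<Rightarrow> 'a triple set \<Rightarrow> bool" where
  "so_query Uso Up L Var Q \<longleftrightarrow>
     query_graph Uso Up L Var Q \<and>
     (\<exists>c \<in> nodes Q. (\<forall>(s, p, t) \<in> Q. s = c \<or> t = c) \<and> (\<exists>(s, p, t) \<in> Q. s = c))"

text \<open>The list \<open>Ns\<close> is the indexed partition: its blocks are non-empty by \<open>partition_on\<close>, and
  \<open>distinct\<close> makes blocks at different indices disjoint.\<close>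

definition s_decomposition :: "'a set \<Rightarrow> 'a triple set \<Rightarrow> 'a triple set list \<Rightarrow> bool" where
  "s_decomposition L G Gs \<longleftrightarrow>
     Gs \<noteq> [] \<and>
     (\<exists>Ns. length Ns = length Gs \<and> distinct Ns \<and> partition_on (nodes G - L) (set Ns) \<and>
        (\<forall>i < length Gs. Gs ! i = {(s, p, t) \<in> G. s \<in> Ns ! i \<or> t \<in> Ns ! i}))"

definition total_embedding ::
    "'a set \<Rightarrow> 'a triple set \<Rightarrow> 'a triple set \<Rightarrow> ('a \<rightharpoonup> 'a) \<Rightarrow> bool" where
  "total_embedding Var Q G e \<longleftrightarrow>
     dom e = nodes Q \<and> ran e \<subseteq> nodes G \<and>
     (\<forall>v \<in> nodes Q - Var. e v = Some v) \<and>
     (\<forall>(v1, p, v2) \<in> Q. (the (e v1), p, the (e v2)) \<in> G)"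

definition compatible :: "('a \<rightharpoonup> 'b) \<Rightarrow> ('a \<rightharpoonup> 'b) \<Rightarrow> bool" where
  "compatible e1 e2 \<longleftrightarrow> (\<forall>v \<in> dom e1 \<inter> dom e2. e1 v = e2 v)"

definition mutually_compatible :: "('a \<rightharpoonup> 'b) list \<Rightarrow> bool" where
  "mutually_compatible es \<longleftrightarrow>
     (\<forall>i < length es. \<forall>j < length es. compatible (es ! i) (es ! j))"

definition map_join :: "('a \<rightharpoonup> 'b) \<Rightarrow> ('a \<rightharpoonup> 'b) \<Rightarrow> ('a \<rightharpoonup> 'b)" where
  "map_join e1 e2 = (\<lambda>v. case e1 v of Some w \<Rightarrow> Some w | None \<Rightarrow> e2 v)"

text \<open>The nowhere defined map is compatible with every map and neutral for \<open>map_join\<close>, so starting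
  from it yields the iterated join of the listed maps.\<close>

definition join_list :: "('a \<rightharpoonup> 'b) list \<Rightarrow> ('a \<rightharpoonup> 'b)" where
  "join_list es = foldl map_join Map.empty es"

end

theory Submission
  imports Defs
begin

text \<open>A triple with the central node \<open>c\<close> as its subject is mapped into \<open>G\<close>, so the image of \<open>c\<close> is a
  subject of \<open>G\<close> and hence not a literal. It therefore lies in some block of the partition, and the
  segment of that block contains the image of the whole star. Restricting an embedding to the stars
  thus gives embeddings into segments, and a map is the join of its restrictions to a cover of its
  domain.\<close>

lemma nodes_UN: "nodes (\<Union>i\<in>I. F i) = (\<Union>i\<in>I. nodes (F i))"
  by (fastforce simp: nodes_def)

lemma nodes_mono: "F \<subseteq> F' \<Longrightarrow> nodes F \<subseteq> nodes F'"
  by (fastforce simp: nodes_def)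

lemma nodesI:
  assumes "(s, p, t) \<in> F"
  shows "s \<in> nodes F" and "t \<in> nodes F"
  using assms by (fastforce simp: nodes_def)+

lemma mutually_compatible_iff_set:
  "mutually_compatible es \<longleftrightarrow> (\<forall>f\<in>set es. \<forall>g\<in>set es. compatible f g)"
  unfolding mutually_compatible_def by (metis in_set_conv_nth)

text \<open>\<open>map_join\<close> gives priority to the earlier map, but compatible maps agree
  wherever both are defined. So the order is irrelevant and the graph of the join is the union of
  the graphs of the listed maps.\<close>

lemma join_list_eq_Some_iff:
  assumes "mutually_compatible es"
  shows "join_list es v = Some w \<longleftrightarrow> (\<exists>f\<in>set es. f v = Some w)"
  using assms
proof (induction es arbitrary: w rule: rev_induct)
  case Nil
  then show ?case by (simp add: join_list_def)
next
  case (snoc g es)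
  have IH: "join_list es v = Some w' \<longleftrightarrow> (\<exists>f\<in>set es. f v = Some w')" for w'
    using snoc by (simp add: mutually_compatible_iff_set)
  have step: "join_list (es @ [g]) v = (case join_list es v of Some w \<Rightarrow> Some w | None \<Rightarrow> g v)"
    by (simp add: join_list_def map_join_def)
  show ?case
  proof (cases "join_list es v")
    case None
    then show ?thesis using IH step by auto
  next
    case (Some u)
    \<comment> \<open>The value \<open>u\<close> comes from an earlier map \<open>f\<close>;
      compatibility with \<open>g\<close> keeps \<open>g\<close> from contributing a different value
      at \<open>v\<close>.\<close>
    then obtain f where f: "f \<in> set es" "f v = Some u" using IH by blast
    then have "compatible f g"
      using snoc.prems by (auto simp: mutually_compatible_iff_set)
    then have "g v = Some w \<Longrightarrow> u = w"
      using f by (force simp: compatible_def)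
    then show ?thesis using Some IH[of w] by (auto simp: step)
  qed
qed

lemma mutually_compatible_restrict: "mutually_compatible (map (\<lambda>A. e |` A) As)"
  by (auto simp: mutually_compatible_iff_set compatible_def restrict_map_def)

lemma join_list_restrict:
  assumes "dom e \<subseteq> \<Union>(set As)"
  shows "join_list (map (\<lambda>A. e |` A) As) = e"
proof
  fix v
  have "join_list (map (\<lambda>A. e |` A) As) v = Some w \<longleftrightarrow> e v = Some w" for w
    unfolding join_list_eq_Some_iff[OF mutually_compatible_restrict]
    using assms by (auto simp: restrict_map_def)
  \<comment> \<open>Agreement on \<open>Some w\<close> for every \<open>w\<close> also settles the
    undefined case.\<close>
  then show "join_list (map (\<lambda>A. e |` A) As) v = e v"
    by (metis option.exhaust)
qed

text \<open>Domain and fixed constants are inherited from \<open>e\<close>. The range bound follows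
  from the triple condition alone, since every node of \<open>Q'\<close> is an end of some triple of
  \<open>Q'\<close>, whose image lies in \<open>G'\<close>.\<close>

lemma total_embedding_restrict:
  assumes e: "total_embedding Var Q G e" and "Q' \<subseteq> Q"
    and img: "\<And>s p t. (s, p, t) \<in> Q' \<Longrightarrow> (the (e s), p, the (e t)) \<in> G'"
  shows "total_embedding Var Q' G' (e |` nodes Q')"
proof -
  have sub: "nodes Q' \<subseteq> nodes Q" using \<open>Q' \<subseteq> Q\<close> by (rule nodes_mono)
  have "the (e v) \<in> nodes G'" if "v \<in> nodes Q'" for v
    using that img nodesI[of _ _ _ G'] by (fastforce simp: nodes_def[of Q'])
  then have "ran (e |` nodes Q') \<subseteq> nodes G'"
    by (auto simp: ran_def restrict_map_def split: if_splits) (metis option.sel)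
  moreover have "dom (e |` nodes Q') = nodes Q'"
    using e sub by (auto simp: total_embedding_def)
  moreover have "\<forall>v \<in> nodes Q' - Var. (e |` nodes Q') v = Some v"
    using e sub by (auto simp: total_embedding_def)
  moreover have "\<forall>(s, p, t) \<in> Q'. (the ((e |` nodes Q') s), p, the ((e |` nodes Q') t)) \<in> G'"
    using img by (auto simp: nodesI)
  ultimately show ?thesis unfolding total_embedding_def by blast
qed

lemma so_query_embeds_in_segment:
  assumes e: "total_embedding Var Q G e" and "Q' \<subseteq> Q"
    and so: "so_query Uso Up L Var Q'"
    and "data_graph Uso Up L G" and "disjnt Uso L"
    and "s_decomposition L G Gs"
  shows "\<exists>j < length Gs. total_embedding Var Q' (Gs ! j) (e |` nodes Q')"
proof -
  have img: "(the (e s), p, the (e t)) \<in> G" if "(s, p, t) \<in> Q'" for s p t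
    using e that \<open>Q' \<subseteq> Q\<close> by (auto simp: total_embedding_def)
  obtain c p t where star: "\<And>s p t. (s, p, t) \<in> Q' \<Longrightarrow> s = c \<or> t = c" and "(c, p, t) \<in> Q'"
    using so by (fastforce simp: so_query_def)
  then have c: "(the (e c), p, the (e t)) \<in> G" using img by blast
  \<comment> \<open>Here the subject position matters: subjects of \<open>G\<close> lie in
    \<open>Uso\<close>, whereas the image of an object could be a literal, which no block
    contains.\<close>
  then have "the (e c) \<in> nodes G - L"
    using assms(4,5) nodesI(1)[OF c] by (auto simp: data_graph_def disjnt_def)
  moreover obtain Ns where "length Ns = length Gs" "partition_on (nodes G - L) (set Ns)"
    and Gs: "\<And>i. i < length Gs \<Longrightarrow> Gs ! i = {(s, p, t) \<in> G. s \<in> Ns ! i \<or> t \<in> Ns ! i}"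
    using assms(6) unfolding s_decomposition_def by blast
  ultimately obtain j where j: "j < length Gs" "the (e c) \<in> Ns ! j"
    by (metis UnionE in_set_conv_nth partition_onD1)
  have "total_embedding Var Q' (Gs ! j) (e |` nodes Q')"
    using e \<open>Q' \<subseteq> Q\<close>
  proof (rule total_embedding_restrict)
    \<comment> \<open>One end of the triple is \<open>c\<close>, so one end of its image lies in
      \<open>Ns ! j\<close>, which is the membership condition of \<open>Gs ! j\<close>.\<close>
    fix s p t assume "(s, p, t) \<in> Q'"
    then show "(the (e s), p, the (e t)) \<in> Gs ! j"
      using img star j Gs by fastforce
  qed
  then show ?thesis using j by blast
qed

text \<open>The subgraph \<open>G'\<close> may vary with \<open>i\<close>: enlarging each target to
  \<open>G\<close> preserves embeddings. Every triple of the union then lies in a single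
  \<open>Qs ! i\<close>, on whose nodes the join agrees with \<open>es ! i\<close>.\<close>

lemma total_embedding_join_list:
  assumes len: "length es = length Qs" and comp: "mutually_compatible es"
    and emb: "\<And>i. i < length Qs \<Longrightarrow> \<exists>G' \<subseteq> G. total_embedding Var (Qs ! i) G' (es ! i)"
  shows "total_embedding Var (\<Union>i < length Qs. Qs ! i) G (join_list es)"
proof -
  let ?Q = "\<Union>i < length Qs. Qs ! i"
  have embG: "total_embedding Var (Qs ! i) G (es ! i)" if "i < length Qs" for i
  proof -
    obtain G' where "G' \<subseteq> G" "total_embedding Var (Qs ! i) G' (es ! i)"
      using emb \<open>i < length Qs\<close> by blast
    then show ?thesis
      using nodes_mono[OF \<open>G' \<subseteq> G\<close>] unfolding total_embedding_def by blast
  qed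
  have join: "join_list es v = Some w \<longleftrightarrow> (\<exists>i < length Qs. (es ! i) v = Some w)" for v w
    using join_list_eq_Some_iff[OF comp] len by (metis in_set_conv_nth)
  \<comment> \<open>Since \<open>es ! i\<close> is total on the nodes of \<open>Qs ! i\<close>, it
    already determines the value of the join there.\<close>
  have agree: "join_list es v = (es ! i) v" if i: "i < length Qs" and v: "v \<in> nodes (Qs ! i)" for i v
  proof -
    obtain w where "(es ! i) v = Some w"
      using embG[OF i] v unfolding total_embedding_def by blast
    then show ?thesis using join i by metis
  qed
  have "dom (join_list es) = (\<Union>i < length Qs. dom (es ! i))"
    by (auto simp: join dom_def)
  also have "\<dots> = nodes ?Q"
    using embG by (simp add: nodes_UN total_embedding_def)
  finally have "dom (join_list es) = nodes ?Q" .
  moreover have "ran (join_list es) \<subseteq> nodes G"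
    using embG by (fastforce simp: ran_def join total_embedding_def)
  moreover have "\<forall>v \<in> nodes ?Q - Var. join_list es v = Some v"
    using embG agree by (auto simp: nodes_UN total_embedding_def)
  moreover have "(the (join_list es s), p, the (join_list es t)) \<in> G"
    if "i < length Qs" "(s, p, t) \<in> Qs ! i" for i s p t
    using embG[OF that(1)] that(2) agree[OF that(1)] nodesI[OF that(2)]
    by (auto simp: total_embedding_def)
  ultimately show ?thesis unfolding total_embedding_def by blast
qed

theorem theorem8:
  fixes Uso Up L Var :: "'a set"
    and Q G :: "'a triple set"
    and Qs Gs :: "'a triple set list"
    and e :: "'a \<rightharpoonup> 'a"
  assumes "vocabulary Uso Up L Var"
    and "query_graph Uso Up L Var Q"
    and "query_decomposition Uso Up L Var Q Qs"
    and "\<forall>i < length Qs. so_query Uso Up L Var (Qs ! i)"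
    and "data_graph Uso Up L G"
    and "s_decomposition L G Gs"
  shows "total_embedding Var Q G e \<longleftrightarrow>
    (\<exists>es. length es = length Qs \<and> mutually_compatible es \<and>
       (\<forall>i < length Qs. \<exists>j < length Gs. total_embedding Var (Qs ! i) (Gs ! j) (es ! i)) \<and>
       e = join_list es)"
proof -
  have Q: "Q = (\<Union>i < length Qs. Qs ! i)" and sub: "\<And>i. i < length Qs \<Longrightarrow> Qs ! i \<subseteq> Q"
    using assms(3) by (auto simp: query_decomposition_def)
  show ?thesis
  proof
    assume e: "total_embedding Var Q G e"
    \<comment> \<open>The witnesses are the restrictions of \<open>e\<close> to the node sets of the
      stars; they agree on overlaps because they come from one map.\<close>
    let ?es = "map (\<lambda>A. e |` A) (map nodes Qs)"
    have "disjnt Uso L" using assms(1) by (simp add: vocabulary_def)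
    then have "\<forall>i < length Qs. \<exists>j < length Gs. total_embedding Var (Qs ! i) (Gs ! j) (?es ! i)"
      using so_query_embeds_in_segment[OF e sub _ assms(5) _ assms(6)] assms(4) by simp
    \<comment> \<open>The stars cover \<open>Q\<close>, so their node sets cover the domain of
      \<open>e\<close>.\<close>
    moreover have "dom e \<subseteq> \<Union>(set (map nodes Qs))"
      using e Q by (auto simp: total_embedding_def nodes_UN intro: nth_mem)
    then have "e = join_list ?es" by (simp only: join_list_restrict)
    moreover have "length ?es = length Qs" by simp
    ultimately show "\<exists>es. length es = length Qs \<and> mutually_compatible es \<and>
       (\<forall>i < length Qs. \<exists>j < length Gs. total_embedding Var (Qs ! i) (Gs ! j) (es ! i)) \<and>
       e = join_list es"
      using mutually_compatible_restrict[of e "map nodes Qs"] by (intro exI[of _ ?es] conjI)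
  next
    assume "\<exists>es. length es = length Qs \<and> mutually_compatible es \<and>
       (\<forall>i < length Qs. \<exists>j < length Gs. total_embedding Var (Qs ! i) (Gs ! j) (es ! i)) \<and>
       e = join_list es"
    then obtain es where es: "length es = length Qs" "mutually_compatible es" "e = join_list es"
      and emb: "\<And>i. i < length Qs \<Longrightarrow>
        \<exists>j < length Gs. total_embedding Var (Qs ! i) (Gs ! j) (es ! i)"
      by blast
    \<comment> \<open>For gluing, all that is kept of a segment is that it is a subgraph of
      \<open>G\<close>.\<close>
    have "\<forall>j < length Gs. Gs ! j \<subseteq> G"
      using assms(6) by (auto simp: s_decomposition_def)
    then have "\<And>i. i < length Qs \<Longrightarrow> \<exists>G' \<subseteq> G. total_embedding Var (Qs ! i) G' (es ! i)"
      using emb by meson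
    then show "total_embedding Var Q G e"
      unfolding Q es(3) by (rule total_embedding_join_list[OF es(1,2)])
  qed
qed

end
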